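(* Let $\theta\in\mathbb R\setminus\mathbb Q$. The following statements are equivalent: (i) $\theta$ is well approximable, i.e. $\theta\in\mathfrak W$. (ii) There exists $\mu\in\mathbb P_\varepsilon$ such that ${}^*\mathbb Z^\mu_\mu(\theta)\ne0$. (iii) There exists a best denominator class of $\theta$ with $\widehat\mu^+<\widehat\mu$. (In particular, $\mathbb P_\varepsilon^{\rm bg}(\theta)$ is not a dense order.) (iv) $\widehat\mu>\widehat\nu$ for some best denominator class of $\theta$.
   Context: Fix a nonprincipal ultrafilter $\mathfrak u$ on $\mathbb N$, and let ${}^*\mathbb Z\subset{}^*\mathbb R$ be the ultrapowers of $\mathbb Z\subset\mathbb R$. Let ${}^*\mathbb R_{\rm fin}$ be the ring of bounded elements, ${}^*\mathbb R_\varepsilon$ its ideal of infinitesimals, and $({}^*\mathbb R_{\rm fin})^\times_+$ the multiplicative group of positive elements that are neither infinite nor infinitesimal. Let $\mathbb P:=({}^*\mathbb R_{>0}\cup\{0\})/({}^*\mathbb R_{\rm fin})^\times_+$; write $\langle x\rangle\in\mathbb P$ for the class of $|x|$, and $-\infty:=\langle0\rangle$. $\mathbb P$ has the induced product and total order ($\mu<\mu'$ iff $x<x'$ for all representatives; $-\infty$ is the minimum). $\mathbb P_\varepsilon\subset\mathbb P$ is the set of classes of positive infinitesimals. For $0\ne n\in{}^*\mathbb Z$ the growth is $\mu(n):=\langle n\rangle^{-1}$. For $\theta\in\mathbb R$, ${}^*\mathbb Z(\theta)$ is the group of $n\in{}^*\mathbb Z$ for which there is a (unique) $n^\perp\in{}^*\mathbb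 Z$ with $\varepsilon(n):=n\theta-n^\perp\in{}^*\mathbb R_\varepsilon$; the decay of $n\in{}^*\mathbb Z(\theta)$ is $\nu(n):=\langle\varepsilon(n)\rangle$. For $\mu,\nu\in\mathbb P_\varepsilon$, ${}^*\mathbb Z^\mu_\nu(\theta):=\{0\neq n\in{}^*\mathbb Z(\theta):\mu(n)>\mu,\ \nu(n)\le\nu\}\cup\{0\}$. $\mathfrak W$ is the set of well approximable numbers: irrational $\theta$ with $\liminf_{n\to\infty}n\|n\theta\|=0$, $\|\cdot\|$ the distance to the nearest integer. Let $\theta\in\mathbb R\setminus\mathbb Q$ have continued fraction expansion $[a_0a_1a_2\dots]$ with convergent denominators $q_0=1$, $q_1=a_1$, $q_{i+1}=a_{i+1}q_i+q_{i-1}$. A best denominator class is the class $\widehat q\in{}^*\mathbb Z(\theta)$ of a sequence $\{q_{n_i}\}_i$ with $n_i\le n_{i+1}$ for all $i$ and $n_i\to\infty$. Its best growth and best decay are $\widehat\mu:=\mu(\widehat q)$, $\widehat\nu:=\nu(\widehat q)$; its successor $\widehat q^+$ is the class of $\{q_{n_i+1}\}$, and $\widehat\mu^+:=\mu(\widehat q^+)$. $\mathbb P_\varepsilon^{\rm bg}(\theta)\subset\mathbb P_\varepsilon$ is the set of all best growths, with the induced order. *)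

theory Defs
  imports "HOL-Analysis.Analysis"
begin

definition nonprincipal_ultrafilter :: "nat filter \<Rightarrow> bool" where
  "nonprincipal_ultrafilter U \<longleftrightarrow>
     U \<noteq> bot \<and>
     (\<forall>P. eventually P U \<or> eventually (\<lambda>i. \<not> P i) U) \<and>
     (\<forall>k. \<not> eventually (\<lambda>i. i = k) U)"

text \<open>A hyperreal is a class of real sequences modulo equality along the ultrafilter, and a
  growth or decay class is a set of hyperreals.  The ultrafilter is a parameter of everything
  below, so ultrapowers are carrier sets rather than types; operations are lifted to the
  quotients by taking unions over representatives.\<close>

type_synonym hyper = "(nat \<Rightarrow> real) set"
type_synonym growth_class = "hyper set"

context
  fixes U :: "nat filter"
begin

definition ueq :: "((nat \<Rightarrow> real) \<times> (nat \<Rightarrow> real)) set" where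
  "ueq = {(f, g). \<forall>\<^sub>F i in U. f i = g i}"

definition hclass :: "(nat \<Rightarrow> real) \<Rightarrow> hyper" where
  "hclass f = ueq `` {f}"

definition hreals :: "hyper set" where
  "hreals = UNIV // ueq"

text \<open>The ultrapower of the integers, identified with its image in the hyperreals.\<close>

definition hints :: "hyper set" where
  "hints = {hclass (\<lambda>i. of_int (k i)) |k. True}"

definition hconst :: "real \<Rightarrow> hyper" where
  "hconst r = hclass (\<lambda>_. r)"

definition habs :: "hyper \<Rightarrow> hyper" where
  "habs x = (\<Union>f\<in>x. hclass (\<lambda>i. \<bar>f i\<bar>))"

definition hinverse :: "hyper \<Rightarrow> hyper" where
  "hinverse x = (\<Union>f\<in>x. hclass (\<lambda>i. inverse (f i)))"

definition hmult :: "hyper \<Rightarrow> hyper \<Rightarrow> hyper" where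
  "hmult x y = (\<Union>f\<in>x. \<Union>g\<in>y. hclass (\<lambda>i. f i * g i))"

definition hdiff :: "hyper \<Rightarrow> hyper \<Rightarrow> hyper" where
  "hdiff x y = (\<Union>f\<in>x. \<Union>g\<in>y. hclass (\<lambda>i. f i - g i))"

definition hless :: "hyper \<Rightarrow> hyper \<Rightarrow> bool" where
  "hless x y \<longleftrightarrow> (\<exists>f\<in>x. \<exists>g\<in>y. \<forall>\<^sub>F i in U. f i < g i)"

definition hfin :: "hyper set" where
  "hfin = {x \<in> hreals. \<exists>r. hless (habs x) (hconst r)}"

definition hinfinitesimals :: "hyper set" where
  "hinfinitesimals = {x \<in> hreals. \<forall>r>0. hless (habs x) (hconst r)}"

definition hfin_pos_units :: "hyper set" where
  "hfin_pos_units = {x \<in> hfin. hless (hconst 0) x \<and> x \<notin> hinfinitesimals}"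

definition hnonneg :: "hyper set" where
  "hnonneg = {x \<in> hreals. hless (hconst 0) x} \<union> {hconst 0}"

definition growth_eq :: "(hyper \<times> hyper) set" where
  "growth_eq = {(x, y). x \<in> hnonneg \<and> y \<in> hnonneg \<and> (\<exists>u\<in>hfin_pos_units. y = hmult u x)}"

definition PP :: "growth_class set" where
  "PP = hnonneg // growth_eq"

definition pclass :: "hyper \<Rightarrow> growth_class" where
  "pclass x = growth_eq `` {habs x}"

definition pinverse :: "growth_class \<Rightarrow> growth_class" where
  "pinverse m = (\<Union>x\<in>m. pclass (hinverse x))"

definition pless :: "growth_class \<Rightarrow> growth_class \<Rightarrow> bool" where
  "pless m m' \<longleftrightarrow> (\<forall>x\<in>m. \<forall>x'\<in>m'. hless x x')"

definition ple :: "growth_class \<Rightarrow> growth_class \<Rightarrow> bool" where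
  "ple m m' \<longleftrightarrow> pless m m' \<or> m = m'"

definition PP_eps :: "growth_class set" where
  "PP_eps = {m \<in> PP. \<exists>x\<in>hinfinitesimals. hless (hconst 0) x \<and> m = pclass x}"

definition growth :: "hyper \<Rightarrow> growth_class" where
  "growth n = pinverse (pclass n)"

definition is_perp :: "real \<Rightarrow> hyper \<Rightarrow> hyper \<Rightarrow> bool" where
  "is_perp \<theta> n m \<longleftrightarrow> m \<in> hints \<and> hdiff (hmult n (hconst \<theta>)) m \<in> hinfinitesimals"

definition dioph_group :: "real \<Rightarrow> hyper set" where
  "dioph_group \<theta> = {n \<in> hints. \<exists>m. is_perp \<theta> n m}"

definition perp :: "real \<Rightarrow> hyper \<Rightarrow> hyper" where
  "perp \<theta> n = (THE m. is_perp \<theta> n m)"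

definition err :: "real \<Rightarrow> hyper \<Rightarrow> hyper" where
  "err \<theta> n = hdiff (hmult n (hconst \<theta>)) (perp \<theta> n)"

definition decay :: "real \<Rightarrow> hyper \<Rightarrow> growth_class" where
  "decay \<theta> n = pclass (err \<theta> n)"

definition growth_decay_group :: "real \<Rightarrow> growth_class \<Rightarrow> growth_class \<Rightarrow> hyper set" where
  "growth_decay_group \<theta> \<mu> \<nu> =
     {n \<in> dioph_group \<theta>. n \<noteq> hconst 0 \<and> pless \<mu> (growth n) \<and> ple (decay \<theta> n) \<nu>} \<union> {hconst 0}"

end

definition well_approximable :: "real set" where
  "well_approximable =
     {\<theta>. \<theta> \<notin> \<rat> \<and> liminf (\<lambda>n. ereal (real n * infdist (real n * \<theta>) \<int>)) = 0}"

primrec cf_complete_quotient :: "real \<Rightarrow> nat \<Rightarrow> real" where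
  "cf_complete_quotient \<theta> 0 = \<theta>"
| "cf_complete_quotient \<theta> (Suc i) = 1 / frac (cf_complete_quotient \<theta> i)"

definition cf_coeff :: "real \<Rightarrow> nat \<Rightarrow> int" where
  "cf_coeff \<theta> i = \<lfloor>cf_complete_quotient \<theta> i\<rfloor>"

fun cf_denom :: "real \<Rightarrow> nat \<Rightarrow> int" where
  "cf_denom \<theta> 0 = 1"
| "cf_denom \<theta> (Suc 0) = cf_coeff \<theta> 1"
| "cf_denom \<theta> (Suc (Suc i)) = cf_coeff \<theta> (Suc (Suc i)) * cf_denom \<theta> (Suc i) + cf_denom \<theta> i"

definition best_index :: "(nat \<Rightarrow> nat) \<Rightarrow> bool" where
  "best_index n \<longleftrightarrow> (\<forall>i. n i \<le> n (Suc i)) \<and> filterlim n at_top sequentially"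

definition best_denoms :: "nat filter \<Rightarrow> real \<Rightarrow> hyper set" where
  "best_denoms U \<theta> = {hclass U (\<lambda>i. of_int (cf_denom \<theta> (n i))) |n. best_index n}"

text \<open>Convergent denominators are strictly increasing from index 1 on, so for irrational
  \<open>\<theta>\<close> and a nonprincipal ultrafilter the successor does not depend on the index sequence.\<close>

definition is_best_succ :: "nat filter \<Rightarrow> real \<Rightarrow> hyper \<Rightarrow> hyper \<Rightarrow> bool" where
  "is_best_succ U \<theta> q q' \<longleftrightarrow>
     (\<exists>n. best_index n \<and>
          q = hclass U (\<lambda>i. of_int (cf_denom \<theta> (n i))) \<and>
          q' = hclass U (\<lambda>i. of_int (cf_denom \<theta> (Suc (n i)))))"

definition best_growths :: "nat filter \<Rightarrow> real \<Rightarrow> growth_class set" where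
  "best_growths U \<theta> = growth U ` best_denoms U \<theta>"

definition dense_order_on :: "('a \<Rightarrow> 'a \<Rightarrow> bool) \<Rightarrow> 'a set \<Rightarrow> bool" where
  "dense_order_on R A \<longleftrightarrow> (\<forall>x\<in>A. \<forall>y\<in>A. R x y \<longrightarrow> (\<exists>z\<in>A. R x z \<and> R z y))"

end

theory Submission
  imports Defs
begin

text \<open>Let \<open>D\<^sub>k = \<bar>q\<^sub>k \<theta> - p\<^sub>k\<bar>\<close>. The identity \<open>q\<^sub>k\<^sub>+\<^sub>1 D\<^sub>k + q\<^sub>k D\<^sub>k\<^sub>+\<^sub>1 = 1\<close> shows that \<open>D\<^sub>k\<close> equals
  \<open>1 / q\<^sub>k\<^sub>+\<^sub>1\<close> up to a factor 2, so the decay of a best denominator class is the growth of its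
  successor, and (iii) and (iv) say the same. If \<open>\<theta>\<close> is well approximable, the best
  approximation law gives convergents with \<open>q\<^sub>k / q\<^sub>k\<^sub>+\<^sub>1\<close> arbitrarily small, and a sequence of
  these is a class as in (iii). From (iv), \<open>\<mu> = \<nu>(q)\<close> is a witness for (ii). Finally a nonzero
  \<open>n\<close> as in (ii) has \<open>\<nu>(n) < \<mu>(n)\<close>, i.e. \<open>n \<epsilon>(n)\<close> is infinitesimal, and \<open>n\<close> is infinite since
  \<open>\<theta>\<close> is irrational, whence \<open>\<theta>\<close> is well approximable. No best growth lies strictly between
  those of a class and its successor, because an ultrafilter decides whether \<open>m\<^sub>i \<le> n\<^sub>i\<close>.\<close>

section \<open>Growth classes of sequences\<close>

locale ultrafilter_on_nat =
  fixes U :: "nat filter"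
  assumes ultra: "nonprincipal_ultrafilter U"
begin

lemma U_not_bot: "U \<noteq> bot"
  using ultra by (simp add: nonprincipal_ultrafilter_def)

text \<open>Properness forbids that a property and its negation both hold along \<open>U\<close>;
  maximality supplies one of them. Every case distinction along \<open>U\<close> rests on
  this.\<close>

lemma not_eventually_iff: "\<not> eventually P U \<longleftrightarrow> eventually (\<lambda>i. \<not> P i) U"
proof -
  have "\<not> (eventually P U \<and> eventually (\<lambda>i. \<not> P i) U)"
  proof
    assume "eventually P U \<and> eventually (\<lambda>i. \<not> P i) U"
    then have "eventually (\<lambda>i. False) U"
      using eventually_elim2[of P U "\<lambda>i. \<not> P i" "\<lambda>i. False"] by blast
    then show False using U_not_bot by (simp add: trivial_limit_def)
  qed
  then show ?thesis using ultra by (auto simp: nonprincipal_ultrafilter_def)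
qed

text \<open>Omitting each single point means omitting each finite set, so \<open>U\<close> contains
  all tails. Limits at infinity thereby become statements along \<open>U\<close>.\<close>

lemma U_le_sequentially: "U \<le> sequentially"
proof (rule filter_leI)
  fix P :: "nat \<Rightarrow> bool" assume "eventually P sequentially"
  then obtain N where N: "\<And>n. n \<ge> N \<Longrightarrow> P n"
    by (auto simp: eventually_sequentially)
  have "\<forall>\<^sub>F i in U. \<forall>k\<in>{..<N}. i \<noteq> k"
    using ultra
    by (subst eventually_ball_finite_distrib) (auto simp: nonprincipal_ultrafilter_def)
  then show "eventually P U"
    by eventually_elim (metis N lessThan_iff not_le)
qed

section \<open>Hyperreals computed on representing sequences\<close>

lemma equiv_ueq: "equiv UNIV (ueq U)"
proof (rule equivI)
  show "trans (ueq U)"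
  proof (rule transI, unfold ueq_def mem_Collect_eq prod.case)
    fix f g h :: "nat \<Rightarrow> real"
    assume "\<forall>\<^sub>F i in U. f i = g i" "\<forall>\<^sub>F i in U. g i = h i"
    then show "\<forall>\<^sub>F i in U. f i = h i" by eventually_elim simp
  qed
qed (auto simp: ueq_def refl_on_def sym_def elim: eventually_mono)

lemma hclass_eq_iff: "hclass U f = hclass U g \<longleftrightarrow> (\<forall>\<^sub>F i in U. f i = g i)"
  unfolding hclass_def using eq_equiv_class_iff[OF equiv_ueq, of f g] by (simp add: ueq_def)

lemma mem_hclass_iff: "g \<in> hclass U f \<longleftrightarrow> (\<forall>\<^sub>F i in U. f i = g i)"
  by (simp add: hclass_def ueq_def)

lemma hclass_in_hreals: "hclass U f \<in> hreals U"
  by (auto simp: hclass_def hreals_def quotient_def)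

lemma hrealsE:
  assumes "x \<in> hreals U" obtains f where "x = hclass U f"
  using assms by (auto simp: hclass_def hreals_def quotient_def)

text \<open>The lifted operations are unions over representatives. A nonempty union of equal sets
  collapses, so a computation rule only requires independence of the representative.\<close>

lemma UN_hclass:
  assumes "\<And>g. \<forall>\<^sub>F i in U. f i = g i \<Longrightarrow> F g = F f"
  shows "(\<Union>g\<in>hclass U f. F g) = F f"
proof -
  have "F g = F f" if "g \<in> hclass U f" for g
    using that assms by (simp only: mem_hclass_iff)
  moreover have "f \<in> hclass U f" by (simp add: mem_hclass_iff)
  ultimately show ?thesis by blast
qed

lemma habs_hclass: "habs U (hclass U f) = hclass U (\<lambda>i. \<bar>f i\<bar>)"
  unfolding habs_def
  by (rule UN_hclass) (auto simp: hclass_eq_iff elim: eventually_mono)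

lemma hinverse_hclass: "hinverse U (hclass U f) = hclass U (\<lambda>i. inverse (f i))"
  unfolding hinverse_def
  by (rule UN_hclass) (auto simp: hclass_eq_iff elim: eventually_mono)

lemma hmult_hclass: "hmult U (hclass U f) (hclass U g) = hclass U (\<lambda>i. f i * g i)"
proof -
  have "(\<Union>g'\<in>hclass U g. hclass U (\<lambda>i. f' i * g' i)) = hclass U (\<lambda>i. f' i * g i)" for f'
    by (rule UN_hclass) (auto simp: hclass_eq_iff elim: eventually_mono)
  then show ?thesis
    unfolding hmult_def
    by (simp, intro UN_hclass) (auto simp: hclass_eq_iff elim: eventually_mono)
qed

lemma hdiff_hclass: "hdiff U (hclass U f) (hclass U g) = hclass U (\<lambda>i. f i - g i)"
proof -
  have "(\<Union>g'\<in>hclass U g. hclass U (\<lambda>i. f' i - g' i)) = hclass U (\<lambda>i. f' i - g i)" for f'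
    by (rule UN_hclass) (auto simp: hclass_eq_iff elim: eventually_mono)
  then show ?thesis
    unfolding hdiff_def
    by (simp, intro UN_hclass) (auto simp: hclass_eq_iff elim: eventually_mono)
qed

lemma hless_hclass: "hless U (hclass U f) (hclass U g) \<longleftrightarrow> (\<forall>\<^sub>F i in U. f i < g i)"
proof
  assume "hless U (hclass U f) (hclass U g)"
  then obtain f' g' where
    "\<forall>\<^sub>F i in U. f i = f' i" "\<forall>\<^sub>F i in U. g i = g' i" "\<forall>\<^sub>F i in U. f' i < g' i"
    by (auto simp: hless_def mem_hclass_iff)
  then show "\<forall>\<^sub>F i in U. f i < g i" by eventually_elim simp
next
  assume "\<forall>\<^sub>F i in U. f i < g i"
  then show "hless U (hclass U f) (hclass U g)"
    unfolding hless_def by (intro bexI[of _ f] bexI[of _ g]) (auto simp: mem_hclass_iff)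
qed

lemma hinfinitesimals_hclass:
  "hclass U f \<in> hinfinitesimals U \<longleftrightarrow> (\<forall>r>0. \<forall>\<^sub>F i in U. \<bar>f i\<bar> < r)"
  by (simp add: hinfinitesimals_def hclass_in_hreals habs_hclass hconst_def hless_hclass)

text \<open>Boundedness supplies \<open>b\<close>. Failing to be infinitesimal supplies a standard
  \<open>a\<close>, and the ultrafilter turns the failure of \<open>\<bar>h i\<bar> < a\<close> into
  a lower bound at almost all indices.\<close>

lemma hfin_pos_units_hclass:
  "hclass U h \<in> hfin_pos_units U \<longleftrightarrow> (\<exists>a>0. \<exists>b. \<forall>\<^sub>F i in U. a \<le> h i \<and> h i < b)"
proof
  assume "hclass U h \<in> hfin_pos_units U"
  then obtain a b where "a > 0" and
    ev: "\<forall>\<^sub>F i in U. \<bar>h i\<bar> < b" "\<forall>\<^sub>F i in U. 0 < h i" "\<forall>\<^sub>F i in U. \<not> \<bar>h i\<bar> < a"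
    by (auto simp: hfin_pos_units_def hfin_def habs_hclass hconst_def hless_hclass
        hinfinitesimals_hclass not_eventually_iff)
  from ev have "\<forall>\<^sub>F i in U. a \<le> h i \<and> h i < b" by eventually_elim auto
  with \<open>a > 0\<close> show "\<exists>a>0. \<exists>b. \<forall>\<^sub>F i in U. a \<le> h i \<and> h i < b" by blast
next
  assume "\<exists>a>0. \<exists>b. \<forall>\<^sub>F i in U. a \<le> h i \<and> h i < b"
  then obtain a b where "a > 0" and ev: "\<forall>\<^sub>F i in U. a \<le> h i \<and> h i < b" by blast
  have "\<forall>\<^sub>F i in U. \<bar>h i\<bar> < b" "\<forall>\<^sub>F i in U. 0 < h i" "\<forall>\<^sub>F i in U. \<not> \<bar>h i\<bar> < a"
    using ev by (eventually_elim, use \<open>a > 0\<close> in linarith)+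
  with \<open>a > 0\<close> show "hclass U h \<in> hfin_pos_units U"
    by (auto simp: hfin_pos_units_def hfin_def habs_hclass hconst_def hless_hclass
        hinfinitesimals_hclass not_eventually_iff hclass_in_hreals)
qed

text \<open>A nonnegative sequence may mix zeros and positive values, whereas \<open>hnonneg\<close>
  separates zero from the positive elements; the ultrafilter decides between the two.\<close>

lemma hnonneg_hclass: "hclass U f \<in> hnonneg U \<longleftrightarrow> (\<forall>\<^sub>F i in U. 0 \<le> f i)"
proof -
  have "(\<forall>\<^sub>F i in U. 0 \<le> f i) \<longleftrightarrow> (\<forall>\<^sub>F i in U. 0 < f i) \<or> (\<forall>\<^sub>F i in U. f i = 0)"
  proof
    assume nn: "\<forall>\<^sub>F i in U. 0 \<le> f i"
    show "(\<forall>\<^sub>F i in U. 0 < f i) \<or> (\<forall>\<^sub>F i in U. f i = 0)"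
    proof (rule disjCI)
      assume "\<not> (\<forall>\<^sub>F i in U. f i = 0)"
      then have "\<forall>\<^sub>F i in U. f i \<noteq> 0" by (simp add: not_eventually_iff)
      with nn show "\<forall>\<^sub>F i in U. 0 < f i" by eventually_elim simp
    qed
  qed (auto elim: eventually_mono)
  then show ?thesis
    by (auto simp: hnonneg_def hclass_in_hreals hconst_def hless_hclass hclass_eq_iff)
qed

section \<open>Comparability up to positive standard factors, and the order on
  \<open>PP\<close>\<close>

definition commensurate :: "(nat \<Rightarrow> real) \<Rightarrow> (nat \<Rightarrow> real) \<Rightarrow> bool" where
  "commensurate f g \<longleftrightarrow>
     (\<exists>a>0. \<exists>b>0. \<forall>\<^sub>F i in U. a * \<bar>f i\<bar> \<le> \<bar>g i\<bar> \<and> \<bar>g i\<bar> \<le> b * \<bar>f i\<bar>)"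

lemma commensurateI:
  assumes "a > 0" "b > 0" "\<forall>\<^sub>F i in U. a * \<bar>f i\<bar> \<le> \<bar>g i\<bar> \<and> \<bar>g i\<bar> \<le> b * \<bar>f i\<bar>"
  shows "commensurate f g"
  using assms unfolding commensurate_def by blast

lemma commensurate_if_abs_eq:
  assumes "\<And>i. \<bar>f i\<bar> = \<bar>g i\<bar>" shows "commensurate f g"
  by (rule commensurateI[of 1 1]) (simp_all add: assms)

lemma commensurate_sym:
  assumes "commensurate f g" shows "commensurate g f"
proof -
  from assms obtain a b where ab: "a > 0" "b > 0"
    and ev: "\<forall>\<^sub>F i in U. a * \<bar>f i\<bar> \<le> \<bar>g i\<bar> \<and> \<bar>g i\<bar> \<le> b * \<bar>f i\<bar>"
    unfolding commensurate_def by blast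
  have "\<forall>\<^sub>F i in U. (1/b) * \<bar>g i\<bar> \<le> \<bar>f i\<bar> \<and> \<bar>f i\<bar> \<le> (1/a) * \<bar>g i\<bar>"
    using ev by eventually_elim (use ab in \<open>auto simp: field_simps\<close>)
  then show ?thesis using ab by (intro commensurateI[of "1/b" "1/a"]) auto
qed

lemma commensurate_trans:
  assumes "commensurate f g" "commensurate g h" shows "commensurate f h"
proof -
  from assms obtain a b c d where pos: "a > 0" "b > 0" "c > 0" "d > 0"
    and ev: "\<forall>\<^sub>F i in U. a * \<bar>f i\<bar> \<le> \<bar>g i\<bar> \<and> \<bar>g i\<bar> \<le> b * \<bar>f i\<bar>"
      "\<forall>\<^sub>F i in U. c * \<bar>g i\<bar> \<le> \<bar>h i\<bar> \<and> \<bar>h i\<bar> \<le> d * \<bar>g i\<bar>"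
    unfolding commensurate_def by blast
  from ev have "\<forall>\<^sub>F i in U. (c * a) * \<bar>f i\<bar> \<le> \<bar>h i\<bar> \<and> \<bar>h i\<bar> \<le> (d * b) * \<bar>f i\<bar>"
  proof eventually_elim
    case (elim i)
    then have "c * (a * \<bar>f i\<bar>) \<le> c * \<bar>g i\<bar>" "d * \<bar>g i\<bar> \<le> d * (b * \<bar>f i\<bar>)"
      using pos by (auto intro: mult_left_mono)
    with elim show ?case by (simp add: mult.assoc)
  qed
  then show ?thesis using pos by (intro commensurateI[of "c * a" "d * b"]) auto
qed

lemma commensurate_inverse:
  assumes "commensurate f g" shows "commensurate (\<lambda>i. inverse (f i)) (\<lambda>i. inverse (g i))"
proof -
  from assms obtain a b where ab: "a > 0" "b > 0"
    and ev: "\<forall>\<^sub>F i in U. a * \<bar>f i\<bar> \<le> \<bar>g i\<bar> \<and> \<bar>g i\<bar> \<le> b * \<bar>f i\<bar>"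
    unfolding commensurate_def by blast
  from ev have "\<forall>\<^sub>F i in U. (1/b) * \<bar>inverse (f i)\<bar> \<le> \<bar>inverse (g i)\<bar> \<and>
      \<bar>inverse (g i)\<bar> \<le> (1/a) * \<bar>inverse (f i)\<bar>"
  proof eventually_elim
    case (elim i)
    show ?case
    \<comment> \<open>The bounds make \<open>f i\<close> and \<open>g i\<close> vanish together; at
      such indices \<open>inverse 0 = 0\<close> makes the claim trivial.\<close>
    proof (cases "f i = 0")
      case False
      with elim ab have "g i \<noteq> 0" by (smt (verit) mult_pos_pos)
      with elim ab False show ?thesis by (auto simp: field_simps abs_inverse)
    qed (use elim in auto)
  qed
  then show ?thesis using ab by (intro commensurateI[of "1/b" "1/a"]) auto
qed

text \<open>A unit is a factor between two positive standard bounds, so equivalence up to units is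
  \<open>commensurate\<close>. Absolute values enter because \<open>pclass\<close> applies
  \<open>habs\<close> first.\<close>

lemma mem_pclass_hclass_iff:
  "y \<in> pclass U (hclass U f) \<longleftrightarrow>
     (\<exists>g. y = hclass U g \<and> (\<forall>\<^sub>F i in U. 0 \<le> g i) \<and> commensurate f g)"
proof
  assume "y \<in> pclass U (hclass U f)"
  then obtain u where y: "y \<in> hnonneg U" and u: "u \<in> hfin_pos_units U"
    and yu: "y = hmult U u (hclass U (\<lambda>i. \<bar>f i\<bar>))"
    by (auto simp: pclass_def growth_eq_def habs_hclass)
  from u have "u \<in> hreals U" by (simp add: hfin_pos_units_def hfin_def)
  then obtain h where h: "u = hclass U h" by (rule hrealsE)
  with u obtain a b where "a > 0" and ev: "\<forall>\<^sub>F i in U. a \<le> h i \<and> h i < b"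
    by (auto simp: hfin_pos_units_hclass)
  define g where "g = (\<lambda>i. h i * \<bar>f i\<bar>)"
  have yg: "y = hclass U g" by (simp add: yu h g_def hmult_hclass)
  \<comment> \<open>\<open>b\<close> comes without a sign condition, while
    \<open>commensurate\<close> asks for a positive constant; hence \<open>max b 1\<close>.\<close>
  have "\<forall>\<^sub>F i in U. a * \<bar>f i\<bar> \<le> \<bar>g i\<bar> \<and> \<bar>g i\<bar> \<le> max b 1 * \<bar>f i\<bar>"
    using ev
  proof eventually_elim
    case (elim i)
    then have "\<bar>g i\<bar> = h i * \<bar>f i\<bar>" using \<open>a > 0\<close> by (simp add: g_def abs_mult)
    with elim show ?case by (auto intro!: mult_right_mono)
  qed
  then have "commensurate f g" using \<open>a > 0\<close> by (intro commensurateI[of a "max b 1"]) auto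
  with yg y show "\<exists>g. y = hclass U g \<and> (\<forall>\<^sub>F i in U. 0 \<le> g i) \<and> commensurate f g"
    by (auto simp: hnonneg_hclass)
next
  assume "\<exists>g. y = hclass U g \<and> (\<forall>\<^sub>F i in U. 0 \<le> g i) \<and> commensurate f g"
  then obtain g a b where y: "y = hclass U g" and nn: "\<forall>\<^sub>F i in U. 0 \<le> g i"
    and ab: "a > 0" "b > 0"
    and ev: "\<forall>\<^sub>F i in U. a * \<bar>f i\<bar> \<le> \<bar>g i\<bar> \<and> \<bar>g i\<bar> \<le> b * \<bar>f i\<bar>"
    by (auto simp: commensurate_def)
  \<comment> \<open>The unit is the quotient of the two sequences. Where \<open>f i = 0\<close> also
    \<open>g i = 0\<close>, and the value 1 keeps \<open>h\<close> between positive bounds; this is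
    why 1 enters both bounds below.\<close>
  define h where "h = (\<lambda>i. if f i = 0 then 1 else g i / \<bar>f i\<bar>)"
  from ev nn have "\<forall>\<^sub>F i in U. min a 1 \<le> h i \<and> h i < max b 1 + 1"
  proof eventually_elim
    case (elim i)
    show ?case
    proof (cases "f i = 0")
      case False
      with elim have "a \<le> h i" "h i \<le> b" by (auto simp: h_def field_simps)
      then show ?thesis by linarith
    qed (auto simp: h_def)
  qed
  then have u: "hclass U h \<in> hfin_pos_units U"
    unfolding hfin_pos_units_hclass using ab
    by (intro exI[of _ "min a 1"] exI[of _ "max b 1 + 1"] conjI) auto
  have "\<forall>\<^sub>F i in U. g i = h i * \<bar>f i\<bar>"
    using ev by eventually_elim (auto simp: h_def)
  then have "y = hmult U (hclass U h) (hclass U (\<lambda>i. \<bar>f i\<bar>))"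
    by (simp add: y hmult_hclass hclass_eq_iff)
  with u nn y show "y \<in> pclass U (hclass U f)"
    by (auto simp: pclass_def growth_eq_def habs_hclass hnonneg_hclass)
qed

lemma pclass_eqI:
  assumes "commensurate f g" shows "pclass U (hclass U f) = pclass U (hclass U g)"
proof (rule set_eqI)
  have "commensurate f h \<longleftrightarrow> commensurate g h" for h
    using commensurate_trans[OF assms] commensurate_trans[OF commensurate_sym[OF assms]] by blast
  then show "x \<in> pclass U (hclass U f) \<longleftrightarrow> x \<in> pclass U (hclass U g)" for x
    by (simp add: mem_pclass_hclass_iff)
qed

text \<open>Inversion respects \<open>commensurate\<close>, so every member of the class contributes
  the same set to the union in \<open>pinverse\<close>, and \<open>\<bar>f\<bar>\<close> shows that
  there is a member.\<close>

lemma growth_hclass: "growth U (hclass U f) = pclass U (hclass U (\<lambda>i. inverse (f i)))"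
proof -
  have "pclass U (hinverse U x) = pclass U (hclass U (\<lambda>i. inverse (f i)))"
    if x: "x \<in> pclass U (hclass U f)" for x
  proof -
    obtain g where "x = hclass U g" "commensurate f g"
      using x by (auto simp: mem_pclass_hclass_iff)
    then show ?thesis
      by (metis pclass_eqI commensurate_inverse commensurate_sym hinverse_hclass)
  qed
  moreover have "hclass U (\<lambda>i. \<bar>f i\<bar>) \<in> pclass U (hclass U f)"
    using commensurate_if_abs_eq[of f "\<lambda>i. \<bar>f i\<bar>"] by (auto simp: mem_pclass_hclass_iff)
  ultimately show ?thesis unfolding growth_def pinverse_def by blast
qed

text \<open>Representatives may be rescaled by any positive standard constant, so the order between
  classes must survive every factor \<open>r\<close>: the quotient of \<open>f\<close> by
  \<open>g\<close> is infinitesimal.\<close>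

lemma pless_pclass_iff:
  "pless U (pclass U (hclass U f)) (pclass U (hclass U g)) \<longleftrightarrow>
     (\<forall>r>0. \<forall>\<^sub>F i in U. \<bar>f i\<bar> < r * \<bar>g i\<bar>)"
proof
  assume L: "pless U (pclass U (hclass U f)) (pclass U (hclass U g))"
  show "\<forall>r>0. \<forall>\<^sub>F i in U. \<bar>f i\<bar> < r * \<bar>g i\<bar>"
  proof (intro allI impI)
    fix r :: real assume "r > 0"
    have "commensurate f (\<lambda>i. \<bar>f i\<bar>)"
      by (rule commensurate_if_abs_eq) simp
    then have "hclass U (\<lambda>i. \<bar>f i\<bar>) \<in> pclass U (hclass U f)"
      by (auto simp: mem_pclass_hclass_iff)
    moreover have "commensurate g (\<lambda>i. r * \<bar>g i\<bar>)"
      using \<open>r > 0\<close> by (intro commensurateI[of r r]) (auto simp: abs_mult)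
    then have "hclass U (\<lambda>i. r * \<bar>g i\<bar>) \<in> pclass U (hclass U g)"
      using \<open>r > 0\<close> by (auto simp: mem_pclass_hclass_iff intro!: exI[of _ "\<lambda>i. r * \<bar>g i\<bar>"])
    ultimately show "\<forall>\<^sub>F i in U. \<bar>f i\<bar> < r * \<bar>g i\<bar>"
      using L unfolding pless_def by (metis hless_hclass)
  qed
next
  assume R: "\<forall>r>0. \<forall>\<^sub>F i in U. \<bar>f i\<bar> < r * \<bar>g i\<bar>"
  show "pless U (pclass U (hclass U f)) (pclass U (hclass U g))"
    unfolding pless_def
  proof (intro ballI)
    fix x y assume "x \<in> pclass U (hclass U f)" "y \<in> pclass U (hclass U g)"
    then obtain f' g' where x: "x = hclass U f'" and y: "y = hclass U g'"
      and f': "commensurate f f'" and g': "commensurate g g'"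
      and nn: "\<forall>\<^sub>F i in U. 0 \<le> g' i"
      by (auto simp: mem_pclass_hclass_iff)
    from f' obtain b where "b > 0" and b: "\<forall>\<^sub>F i in U. \<bar>f' i\<bar> \<le> b * \<bar>f i\<bar>"
      unfolding commensurate_def by (metis (mono_tags, lifting) eventually_mono)
    from g' obtain a where "a > 0" and a: "\<forall>\<^sub>F i in U. a * \<bar>g i\<bar> \<le> \<bar>g' i\<bar>"
      unfolding commensurate_def by (metis (mono_tags, lifting) eventually_mono)
    \<comment> \<open>The factor \<open>a / b\<close> absorbs the constants relating
      \<open>f'\<close> to \<open>f\<close> and \<open>g'\<close> to \<open>g\<close>.\<close>
    have "\<forall>\<^sub>F i in U. \<bar>f i\<bar> < a / b * \<bar>g i\<bar>"
      using R divide_pos_pos[OF \<open>a > 0\<close> \<open>b > 0\<close>] by blast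
    with a b nn have "\<forall>\<^sub>F i in U. f' i < g' i"
    proof eventually_elim
      case (elim i)
      have "b * \<bar>f i\<bar> < a * \<bar>g i\<bar>" using elim(4) \<open>b > 0\<close> by (simp add: field_simps)
      with elim show ?case by linarith
    qed
    then show "hless U x y" by (simp add: x y hless_hclass)
  qed
qed

lemma pless_pclass_trans:
  assumes "pless U (pclass U (hclass U f)) (pclass U (hclass U g))"
    and "pless U (pclass U (hclass U g)) (pclass U (hclass U h))"
  shows "pless U (pclass U (hclass U f)) (pclass U (hclass U h))"
  unfolding pless_pclass_iff
proof (intro allI impI)
  fix r :: real assume "r > 0"
  have "\<forall>\<^sub>F i in U. \<bar>f i\<bar> < 1 * \<bar>g i\<bar>" "\<forall>\<^sub>F i in U. \<bar>g i\<bar> < r * \<bar>h i\<bar>"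
    using assms \<open>r > 0\<close> zero_less_one unfolding pless_pclass_iff by blast+
  then show "\<forall>\<^sub>F i in U. \<bar>f i\<bar> < r * \<bar>h i\<bar>" by eventually_elim linarith
qed

text \<open>\<open>perp\<close> is a definite description, so uniqueness is required: two integers
  within 1/2 of the same real agree. Any explicit approximating sequence \<open>m\<close> then
  computes the decay.\<close>

lemma decay_hclass:
  assumes "\<forall>r>0. \<forall>\<^sub>F i in U. \<bar>f i * \<theta> - of_int (m i)\<bar> < r"
  shows "decay U \<theta> (hclass U f) = pclass U (hclass U (\<lambda>i. f i * \<theta> - of_int (m i)))"
    and "is_perp U \<theta> (hclass U f) (hclass U (\<lambda>i. of_int (m i)))"
proof -
  show p: "is_perp U \<theta> (hclass U f) (hclass U (\<lambda>i. of_int (m i)))"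
    using assms unfolding is_perp_def hints_def
    by (auto simp: hconst_def hmult_hclass hdiff_hclass hinfinitesimals_hclass)
  have "x = hclass U (\<lambda>i. of_int (m i))" if "is_perp U \<theta> (hclass U f) x" for x
  proof -
    from that obtain k where x: "x = hclass U (\<lambda>i. of_int (k i))"
      and "\<forall>r>0. \<forall>\<^sub>F i in U. \<bar>f i * \<theta> - of_int (k i)\<bar> < r"
      unfolding is_perp_def hints_def
      by (auto simp: hconst_def hmult_hclass hdiff_hclass hinfinitesimals_hclass)
    then have "\<forall>\<^sub>F i in U. \<bar>f i * \<theta> - of_int (k i)\<bar> < 1/2"
      and "\<forall>\<^sub>F i in U. \<bar>f i * \<theta> - of_int (m i)\<bar> < 1/2"
      using assms half_gt_zero[OF zero_less_one] by blast+
    then have "\<forall>\<^sub>F i in U. k i = m i"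
      by eventually_elim linarith
    then show ?thesis by (simp add: x hclass_eq_iff)
  qed
  with p have "perp U \<theta> (hclass U f) = hclass U (\<lambda>i. of_int (m i))"
    unfolding perp_def by (intro the_equality)
  then show "decay U \<theta> (hclass U f) = pclass U (hclass U (\<lambda>i. f i * \<theta> - of_int (m i)))"
    by (simp add: decay_def err_def hconst_def hmult_hclass hdiff_hclass)
qed

lemma dioph_groupE:
  assumes "n \<in> dioph_group U \<theta>"
  obtains k m :: "nat \<Rightarrow> int" where "n = hclass U (\<lambda>i. of_int (k i))"
    and "\<forall>r>0. \<forall>\<^sub>F i in U. \<bar>of_int (k i) * \<theta> - of_int (m i)\<bar> < r"
  using assms that unfolding dioph_group_def hints_def is_perp_def
  by (auto simp: hconst_def hmult_hclass hdiff_hclass hinfinitesimals_hclass)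

end

section \<open>Continued fractions of irrational numbers\<close>

fun cf_numer :: "real \<Rightarrow> nat \<Rightarrow> int" where
  "cf_numer \<theta> 0 = cf_coeff \<theta> 0"
| "cf_numer \<theta> (Suc 0) = cf_coeff \<theta> 1 * cf_coeff \<theta> 0 + 1"
| "cf_numer \<theta> (Suc (Suc i)) = cf_coeff \<theta> (Suc (Suc i)) * cf_numer \<theta> (Suc i) + cf_numer \<theta> i"

text \<open>For irrational \<open>\<theta>\<close> this product is \<open>D_k\<close> (see
  \<open>abs_cf_error\<close>). Positivity and strict decrease are immediate in this form, as all
  factors lie strictly between 0 and 1.\<close>

definition cf_dist :: "real \<Rightarrow> nat \<Rightarrow> real" where
  "cf_dist \<theta> k = (\<Prod>i\<le>k. frac (cf_complete_quotient \<theta> i))"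

locale irrational =
  fixes \<theta> :: real
  assumes irrational: "\<theta> \<notin> \<rat>"
begin

section \<open>Positivity and growth of the denominators\<close>

lemma cf_complete_quotient_irrational: "cf_complete_quotient \<theta> i \<notin> \<rat>"
proof (induction i)
  case (Suc i)
  show ?case
  proof
    assume "cf_complete_quotient \<theta> (Suc i) \<in> \<rat>"
    then have "1 / cf_complete_quotient \<theta> (Suc i) \<in> \<rat>"
      by (intro Rats_divide) auto
    then have "frac (cf_complete_quotient \<theta> i) + of_int \<lfloor>cf_complete_quotient \<theta> i\<rfloor> \<in> \<rat>"
      by (intro Rats_add) auto
    with Suc show False by (simp add: frac_def)
  qed
qed (simp add: irrational)

lemma frac_cf_pos: "0 < frac (cf_complete_quotient \<theta> i)"
  using cf_complete_quotient_irrational[of i] by (metis Ints_subset_Rats frac_gt_0_iff subsetD)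

lemma cf_coeff_pos: "1 \<le> cf_coeff \<theta> (Suc i)"
  using frac_cf_pos[of i] frac_lt_1[of "cf_complete_quotient \<theta> i"]
  by (simp add: cf_coeff_def le_floor_iff)

lemma cf_denom_pos: "0 < cf_denom \<theta> i"
proof -
  have "0 < cf_denom \<theta> i \<and> 0 < cf_denom \<theta> (Suc i)"
  proof (induction i)
    case 0
    show ?case using cf_coeff_pos[of 0] by simp
  next
    case (Suc i)
    have "0 < cf_coeff \<theta> (Suc (Suc i)) * cf_denom \<theta> (Suc i)"
      using Suc cf_coeff_pos[of "Suc i"] by simp
    with Suc show ?case by simp
  qed
  then show ?thesis ..
qed

lemma cf_denom_Suc_Suc_ge: "cf_denom \<theta> (Suc i) + cf_denom \<theta> i \<le> cf_denom \<theta> (Suc (Suc i))"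
  using cf_coeff_pos[of "Suc i"] cf_denom_pos[of "Suc i"] by (simp add: mult_le_cancel_right1)

lemma cf_denom_mono: "i \<le> j \<Longrightarrow> cf_denom \<theta> i \<le> cf_denom \<theta> j"
proof (rule lift_Suc_mono_le[where f = "cf_denom \<theta>"])
  show "cf_denom \<theta> n \<le> cf_denom \<theta> (Suc n)" for n
  proof (cases n)
    case 0
    then show ?thesis using cf_coeff_pos[of 0] by simp
  next
    case (Suc m)
    then show ?thesis using cf_denom_Suc_Suc_ge[of m] cf_denom_pos[of m]
      by (simp del: cf_denom.simps)
  qed
qed

lemma cf_denom_ge: "int i \<le> cf_denom \<theta> i"
proof (induction i)
  case (Suc i)
  show ?case
  proof (cases i)
    case 0
    then show ?thesis using cf_denom_pos[of 1] by simp
  next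
    case (Suc m)
    then show ?thesis using Suc.IH cf_denom_Suc_Suc_ge[of m] cf_denom_pos[of m]
      by (simp del: cf_denom.simps)
  qed
qed simp

section \<open>Errors of the convergents\<close>

lemma cf_dist_pos: "0 < cf_dist \<theta> k"
  unfolding cf_dist_def by (intro prod_pos ballI frac_cf_pos)

lemma cf_dist_Suc: "cf_dist \<theta> (Suc k) = cf_dist \<theta> k * frac (cf_complete_quotient \<theta> (Suc k))"
  by (simp add: cf_dist_def)

lemma cf_dist_Suc_less: "cf_dist \<theta> (Suc k) < cf_dist \<theta> k"
  using cf_dist_pos[of k] frac_lt_1[of "cf_complete_quotient \<theta> (Suc k)"]
  by (simp only: cf_dist_Suc) simp

text \<open>The complete quotient of index \<open>k + 2\<close> is the inverse of the last factor of
  \<open>D_(k+1)\<close>, so their product with \<open>D_(k+1)\<close> restores \<open>D_k\<close>.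
  Splitting that quotient into floor and fractional part gives the recurrence.\<close>

lemma cf_dist_Suc_Suc:
  "cf_dist \<theta> (Suc (Suc k)) = cf_dist \<theta> k - cf_coeff \<theta> (Suc (Suc k)) * cf_dist \<theta> (Suc k)"
proof -
  have "cf_dist \<theta> (Suc k) * cf_complete_quotient \<theta> (Suc (Suc k)) = cf_dist \<theta> k"
    using frac_cf_pos[of "Suc k"] by (simp add: cf_dist_Suc del: cf_complete_quotient.simps(2))
      (simp add: cf_complete_quotient.simps(2)[of \<theta> "Suc k"] del: cf_complete_quotient.simps)
  then show ?thesis
    by (simp add: cf_dist_Suc[of "Suc k"] frac_def cf_coeff_def algebra_simps
        del: cf_complete_quotient.simps)
qed

lemma cf_dist_0: "cf_dist \<theta> 0 = \<theta> - cf_coeff \<theta> 0"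
  by (simp add: cf_dist_def frac_def cf_coeff_def)

lemma cf_dist_1: "cf_dist \<theta> (Suc 0) = 1 - cf_coeff \<theta> 1 * cf_dist \<theta> 0"
proof -
  have "cf_dist \<theta> 0 * cf_complete_quotient \<theta> 1 = 1"
    using frac_cf_pos[of 0] by (simp add: cf_dist_def)
  then show ?thesis
    by (simp add: cf_dist_Suc[of 0] frac_def cf_coeff_def algebra_simps
        del: cf_complete_quotient.simps)
qed

text \<open>Both sides obey the same recurrence, the alternating sign absorbing the minus in
  \<open>cf_dist_Suc_Suc\<close>. The recurrence has order two, so the induction carries two
  consecutive indices.\<close>

lemma cf_error: "cf_denom \<theta> k * \<theta> - cf_numer \<theta> k = (-1) ^ k * cf_dist \<theta> k"
proof -
  have "cf_denom \<theta> k * \<theta> - cf_numer \<theta> k = (-1) ^ k * cf_dist \<theta> k \<and>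
    cf_denom \<theta> (Suc k) * \<theta> - cf_numer \<theta> (Suc k) = (-1) ^ Suc k * cf_dist \<theta> (Suc k)"
  proof (induction k)
    case 0
    show ?case by (simp add: cf_dist_1 cf_dist_0 algebra_simps)
  next
    case (Suc k)
    let ?a = "real_of_int (cf_coeff \<theta> (Suc (Suc k)))"
    have "cf_denom \<theta> (Suc (Suc k)) * \<theta> - cf_numer \<theta> (Suc (Suc k)) =
        ?a * (cf_denom \<theta> (Suc k) * \<theta> - cf_numer \<theta> (Suc k)) + (cf_denom \<theta> k * \<theta> - cf_numer \<theta> k)"
      by (simp add: algebra_simps)
    also have "\<dots> = (-1) ^ Suc (Suc k) * cf_dist \<theta> (Suc (Suc k))"
      unfolding Suc[THEN conjunct1] Suc[THEN conjunct2] cf_dist_Suc_Suc by (simp add: algebra_simps)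
    finally show ?case using Suc by blast
  qed
  then show ?thesis ..
qed

lemma abs_cf_error: "\<bar>cf_denom \<theta> k * \<theta> - cf_numer \<theta> k\<bar> = cf_dist \<theta> k"
  using cf_dist_pos[of k] by (simp add: cf_error abs_mult)

text \<open>The left side is invariant in \<open>k\<close>: after inserting both recurrences, the
  terms with the new coefficient cancel.\<close>

lemma cf_denom_dist_sum:
  "cf_denom \<theta> (Suc k) * cf_dist \<theta> k + cf_denom \<theta> k * cf_dist \<theta> (Suc k) = 1"
proof (induction k)
  case 0
  show ?case by (simp add: cf_dist_1)
next
  case (Suc k)
  then show ?case by (simp add: cf_dist_Suc_Suc algebra_simps)
qed

lemma cf_dist_le: "cf_dist \<theta> k \<le> inverse (cf_denom \<theta> (Suc k))"
proof -
  have "0 \<le> cf_denom \<theta> k * cf_dist \<theta> (Suc k)"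
    using cf_denom_pos[of k] cf_dist_pos[of "Suc k"] by simp
  then have "cf_denom \<theta> (Suc k) * cf_dist \<theta> k \<le> 1" using cf_denom_dist_sum[of k] by linarith
  then show ?thesis using cf_denom_pos[of "Suc k"]
    by (simp add: field_simps del: cf_denom.simps)
qed

text \<open>In \<open>cf_denom_dist_sum\<close> the first summand is the larger one, since
  denominators grow and distances shrink; it is therefore at least 1/2.\<close>

lemma cf_dist_ge: "inverse (cf_denom \<theta> (Suc k)) / 2 \<le> cf_dist \<theta> k"
proof -
  have "cf_denom \<theta> k * cf_dist \<theta> (Suc k) \<le> cf_denom \<theta> (Suc k) * cf_dist \<theta> k"
    using cf_denom_pos[of k] cf_dist_pos[of "Suc k"] cf_dist_Suc_less[of k] cf_denom_mono[of k "Suc k"]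
    by (intro mult_mono) auto
  then have "1 \<le> 2 * (cf_denom \<theta> (Suc k) * cf_dist \<theta> k)" using cf_denom_dist_sum[of k] by linarith
  then show ?thesis using cf_denom_pos[of "Suc k"]
    by (simp add: field_simps del: cf_denom.simps)
qed

lemma cf_determinant:
  "cf_numer \<theta> (Suc k) * cf_denom \<theta> k - cf_numer \<theta> k * cf_denom \<theta> (Suc k) = (-1) ^ k"
proof (induction k)
  case (Suc k)
  then show ?case by (simp add: algebra_simps)
qed simp

text \<open>Expand \<open>(n, m) = x (q\<^sub>k, p\<^sub>k) + y (q\<^sub>k\<^sub>+\<^sub>1, p\<^sub>k\<^sub>+\<^sub>1)\<close> over the integers. As \<open>0 < n < q\<^sub>k\<^sub>+\<^sub>1\<close>,
  \<open>x \<noteq> 0\<close> and \<open>x y \<le> 0\<close>, so the two error terms, whose signs alternate, add up.\<close>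

lemma cf_best_approximation:
  assumes "n \<noteq> 0" "\<bar>n\<bar> < cf_denom \<theta> (Suc k)"
  shows "cf_dist \<theta> k \<le> \<bar>of_int n * \<theta> - of_int m\<bar>"
proof -
  define p q p' q' where "p = cf_numer \<theta> k" and "q = cf_denom \<theta> k"
    and "p' = cf_numer \<theta> (Suc k)" and "q' = cf_denom \<theta> (Suc k)"
  define s where "s = (-1 :: int) ^ k"
  \<comment> \<open>Cramer's rule: the determinant \<open>s\<close> is its own inverse, so the
    coefficients are integers.\<close>
  define x where "x = s * (n * p' - m * q')"
  define y where "y = s * (m * q - n * p)"
  have ss: "s * s = 1" by (simp add: s_def flip: power_mult_distrib)
  have det: "p' * q - p * q' = s"
    unfolding p_def q_def p'_def q'_def s_def by (rule cf_determinant)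
  have "x * q + y * q' = s * (n * (p' * q - p * q'))"
    by (simp add: x_def y_def algebra_simps)
  then have n: "n = x * q + y * q'" using det ss by (simp add: mult.left_commute)
  have "x * p + y * p' = s * (m * (p' * q - p * q'))"
    by (simp add: x_def y_def algebra_simps)
  then have m: "m = x * p + y * p'" using det ss by (simp add: mult.left_commute)
  have q: "0 < q" "0 < q'" by (simp_all only: q_def q'_def cf_denom_pos)
  have nq': "\<bar>n\<bar> < q'" using assms by (simp only: q'_def)
  \<comment> \<open>Otherwise \<open>n\<close> would be a nonzero multiple of \<open>q'\<close>,
    which exceeds \<open>\<bar>n\<bar>\<close>.\<close>
  have x0: "x \<noteq> 0"
  proof
    assume "x = 0"
    with n have n': "n = y * q'" by simp
    with assms have "1 \<le> \<bar>y\<bar>" by auto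
    then have "q' \<le> \<bar>n\<bar>" using q by (simp add: n' abs_mult mult_le_cancel_right1)
    with nq' show False by simp
  qed
  have opp: "(x > 0 \<longrightarrow> y \<le> 0) \<and> (x < 0 \<longrightarrow> y \<ge> 0)"
  proof (intro conjI impI leI notI)
    assume "x > 0" "0 < y"
    then have "0 < x * q" "q' \<le> y * q'" using q by auto
    with n nq' show False by linarith
  next
    assume "x < 0" "y < 0"
    then have "x * q < 0" "y * q' \<le> - q'" using q mult_right_mono[of y "-1" q']
      by (auto simp: mult_neg_pos)
    with n nq' show False by linarith
  qed
  define D D' where "D = cf_dist \<theta> k" and "D' = cf_dist \<theta> (Suc k)"
  have D: "0 < D" "0 < D'" by (simp_all only: D_def D'_def cf_dist_pos)
  have "of_int n * \<theta> - of_int m = x * (q * \<theta> - p) + y * (q' * \<theta> - p')"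
    by (subst n, subst m) (simp add: algebra_simps)
  also have "\<dots> = (-1) ^ k * (x * D - y * D')"
    by (simp only: p_def q_def p'_def q'_def cf_error D_def D'_def) (simp add: algebra_simps)
  finally have "\<bar>of_int n * \<theta> - of_int m\<bar> = \<bar>x * D - y * D'\<bar>" by (simp add: abs_mult)
  moreover have "D \<le> \<bar>x * D - y * D'\<bar>"
  proof (cases "x > 0")
    case True
    then have "D \<le> x * D" "y * D' \<le> 0"
      using D opp by (auto simp: mult_le_cancel_right1 mult_nonpos_nonneg)
    then show ?thesis by linarith
  next
    case False
    with x0 have "x \<le> -1" "y \<ge> 0" using opp by auto
    then have "x * D \<le> -1 * D" "0 \<le> y * D'" using D by (intro mult_right_mono mult_nonneg_nonneg; simp)+
    then show ?thesis by linarith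
  qed
  ultimately show ?thesis by (simp add: D_def)
qed

section \<open>Well approximability read off the convergents\<close>

lemma well_approximable_iff:
  "\<theta> \<in> well_approximable \<longleftrightarrow>
     (\<forall>e>0. \<forall>N. \<exists>n\<ge>N. real n * infdist (real n * \<theta>) \<int> < e)"
proof -
  let ?x = "\<lambda>n. real n * infdist (real n * \<theta>) \<int>"
  have nn: "0 \<le> ?x n" for n by (simp add: infdist_nonneg)
  have "liminf (\<lambda>n. ereal (?x n)) = 0 \<longleftrightarrow> liminf (\<lambda>n. ereal (?x n)) \<le> 0"
    using Liminf_bounded[of 0 "\<lambda>n. ereal (?x n)" sequentially] nn by (auto intro: antisym)
  also have "\<dots> \<longleftrightarrow> (\<forall>e>0. \<forall>N. \<exists>n\<ge>N. ?x n < e)"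
  proof safe
    fix e :: real and N assume "liminf (\<lambda>n. ereal (?x n)) \<le> 0" "e > 0"
    then have "\<not> ereal e \<le> liminf (\<lambda>n. ereal (?x n))"
      by (auto simp: not_le intro: le_less_trans)
    then have "\<not> (\<forall>\<^sub>F n in sequentially. ereal e \<le> ereal (?x n))"
      by (rule contrapos_nn) (rule Liminf_bounded)
    then show "\<exists>n\<ge>N. ?x n < e" by (auto simp: eventually_sequentially not_le)
  next
    assume *: "\<forall>e>0. \<forall>N. \<exists>n\<ge>N. ?x n < e"
    show "liminf (\<lambda>n. ereal (?x n)) \<le> 0"
    proof (rule ccontr)
      assume "\<not> ?thesis"
      then have "0 < liminf (\<lambda>n. ereal (?x n))" by (simp only: not_le)
      \<comment> \<open>A positive liminf leaves room for a real \<open>e\<close> below it, which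
        almost all terms exceed.\<close>
      then obtain e where "0 < ereal e" "ereal e < liminf (\<lambda>n. ereal (?x n))"
        using ereal_dense2 by blast
      then have "e > 0" "\<forall>\<^sub>F n in sequentially. ereal e < ereal (?x n)"
        by (auto dest: less_LiminfD)
      then show False using * by (auto simp: eventually_sequentially) (meson less_asym)
    qed
  qed
  finally show ?thesis using irrational by (simp add: well_approximable_def)
qed

text \<open>For \<open>n\<close> with small \<open>n * infdist (n * \<theta>) \<int>\<close>, take
  the last \<open>k\<close> with \<open>q_k \<le> n\<close>. Best approximation bounds
  \<open>D_k\<close> by the error of \<open>n\<close>, and \<open>q_k / q_(k+1)\<close> is at most
  \<open>2 * n * D_k\<close>.\<close>

lemma well_approximable_convergents:
  assumes "\<theta> \<in> well_approximable" "e > 0"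
  shows "\<exists>k\<ge>N. cf_denom \<theta> k / cf_denom \<theta> (Suc k) < e"
proof -
  \<comment> \<open>The lower bound on \<open>n\<close> will force \<open>k \<ge> N\<close>; the
    half compensates the factor 2 from \<open>cf_dist_ge\<close>.\<close>
  obtain n where n: "n \<ge> nat (cf_denom \<theta> N)" "real n * infdist (real n * \<theta>) \<int> < e / 2"
    using assms unfolding well_approximable_iff by (meson half_gt_zero)
  have nq: "cf_denom \<theta> N \<le> int n" using n(1) by simp
  then have n0: "n > 0" using cf_denom_pos[of N] by simp
  then have "infdist (real n * \<theta>) \<int> < e / 2 / n" using n(2) by (simp add: field_simps)
  then have "\<exists>z\<in>\<int>. dist (real n * \<theta>) z < e / 2 / n"
    by (subst (asm) infdist_notempty, use Ints_0 in blast, subst (asm) cINF_less_iff)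
      (use Ints_0 in \<open>auto intro!: bdd_belowI[of _ 0]\<close>)
  then obtain m :: int where m: "\<bar>real n * \<theta> - m\<bar> < e / 2 / n"
    by (auto simp: dist_real_def elim!: Ints_cases)
  define k where "k = (GREATEST k. cf_denom \<theta> k \<le> int n)"
  \<comment> \<open>Bounds the candidates, so that the greatest one exists.\<close>
  have bd: "\<And>j. cf_denom \<theta> j \<le> int n \<Longrightarrow> j \<le> n"
    using cf_denom_ge by (meson of_nat_le_iff order_trans)
  have kn: "cf_denom \<theta> k \<le> int n"
    unfolding k_def using GreatestI_nat[where P = "\<lambda>k. cf_denom \<theta> k \<le> int n"] nq bd by blast
  have "k \<ge> N"
    unfolding k_def using Greatest_le_nat[where P = "\<lambda>k. cf_denom \<theta> k \<le> int n"] nq bd by blast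
  have "\<not> cf_denom \<theta> (Suc k) \<le> int n"
    using Greatest_le_nat[where P = "\<lambda>k. cf_denom \<theta> k \<le> int n" and k = "Suc k" and b = n] bd
    unfolding k_def by fastforce
  then have "cf_dist \<theta> k \<le> \<bar>of_int (int n) * \<theta> - of_int m\<bar>"
    using n0 by (intro cf_best_approximation) auto
  with m have D: "cf_dist \<theta> k < e / 2 / n" by simp
  have "cf_denom \<theta> k / cf_denom \<theta> (Suc k) \<le> n * (2 * cf_dist \<theta> k)"
    unfolding divide_inverse using kn cf_denom_pos[of k] cf_dist_ge[of k] cf_denom_pos[of "Suc k"]
    by (intro mult_mono) (auto simp del: cf_denom.simps)
  also have "\<dots> < e" using D n0 by (simp add: field_simps)
  finally show ?thesis using \<open>k \<ge> N\<close> by blast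
qed

lemma well_approximable_best_index:
  assumes "\<theta> \<in> well_approximable"
  obtains n where "best_index n"
    and "\<And>j. cf_denom \<theta> (n j) / cf_denom \<theta> (Suc (n j)) < 1 / Suc j"
proof -
  let ?r = "\<lambda>k. real_of_int (cf_denom \<theta> k) / cf_denom \<theta> (Suc k)"
  \<comment> \<open>Each index is chosen beyond the previous one, so the sequence is strictly
    increasing and qualifies for \<open>best_index\<close>.\<close>
  have "\<exists>n. \<forall>j. ?r (n j) < 1 / Suc j \<and> n j < n (Suc j)"
  proof (rule dependent_nat_choice)
    show "\<exists>k. ?r k < 1 / Suc 0"
      using well_approximable_convergents[OF assms, of "1 / Suc 0" 0] by auto
    show "\<exists>k'. ?r k' < 1 / Suc (Suc j) \<and> k < k'" for k j
      using well_approximable_convergents[OF assms, of "1 / Suc (Suc j)" "Suc k"]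
      by (auto simp: Suc_le_eq simp del: cf_denom.simps)
  qed
  then obtain n where r: "\<And>j. ?r (n j) < 1 / Suc j" and "\<And>j. n j < n (Suc j)" by blast
  then have sm: "strict_mono n" by (simp add: strict_mono_Suc_iff)
  then have "best_index n"
    unfolding best_index_def by (simp add: filterlim_subseq strict_mono_less_eq)
  with r that show ?thesis by blast
qed

end

section \<open>Best denominator classes\<close>

locale ultra_irrational = ultrafilter_on_nat U + irrational \<theta> for U \<theta>
begin

lemma best_index_eventually_ge:
  assumes "best_index n" shows "\<forall>\<^sub>F i in U. N \<le> n i"
proof -
  have "\<forall>\<^sub>F i in sequentially. N \<le> n i"
    using assms by (simp add: best_index_def filterlim_at_top)
  then show ?thesis using U_le_sequentially by (simp add: le_filter_def)
qed

text \<open>The error at index \<open>k\<close> is at most \<open>1 / q_(k+1)\<close>, hence at most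
  \<open>1 / (k + 1)\<close>, and \<open>n\<close> tends to infinity along \<open>U\<close>.\<close>

lemma best_denom_error_infinitesimal:
  assumes "best_index n"
  shows "\<forall>r>0. \<forall>\<^sub>F i in U. \<bar>cf_denom \<theta> (n i) * \<theta> - cf_numer \<theta> (n i)\<bar> < r"
proof (intro allI impI)
  fix r :: real assume "r > 0"
  obtain N where N: "inverse (Suc N) < r" using reals_Archimedean[OF \<open>r > 0\<close>] by blast
  show "\<forall>\<^sub>F i in U. \<bar>cf_denom \<theta> (n i) * \<theta> - cf_numer \<theta> (n i)\<bar> < r"
    using best_index_eventually_ge[OF assms, of N]
  proof eventually_elim
    case (elim i)
    have "int (Suc N) \<le> cf_denom \<theta> (Suc (n i))"
      using cf_denom_ge[of "Suc (n i)"] elim by linarith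
    then have "real (Suc N) \<le> cf_denom \<theta> (Suc (n i))" by linarith
    then have "inverse (real_of_int (cf_denom \<theta> (Suc (n i)))) \<le> inverse (Suc N)"
      by (intro le_imp_inverse_le) auto
    with N cf_dist_le[of "n i"] show ?case unfolding abs_cf_error by linarith
  qed
qed

lemma best_denom_in_dioph_group:
  assumes "best_index n" shows "hclass U (\<lambda>i. cf_denom \<theta> (n i)) \<in> dioph_group U \<theta>"
  using decay_hclass(2)[OF best_denom_error_infinitesimal[OF assms]]
  by (auto simp: dioph_group_def hints_def)

lemma decay_best_denom:
  assumes "best_index n"
  shows "decay U \<theta> (hclass U (\<lambda>i. cf_denom \<theta> (n i))) = pclass U (hclass U (\<lambda>i. cf_dist \<theta> (n i)))"
proof -
  have "commensurate (\<lambda>i. cf_denom \<theta> (n i) * \<theta> - cf_numer \<theta> (n i)) (\<lambda>i. cf_dist \<theta> (n i))"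
    by (rule commensurate_if_abs_eq) (simp add: abs_cf_error abs_of_pos[OF cf_dist_pos])
  then show ?thesis
    using decay_hclass(1)[OF best_denom_error_infinitesimal[OF assms]] pclass_eqI by simp
qed

text \<open>\<open>cf_dist_ge\<close> and \<open>cf_dist_le\<close> make the two sequences
  commensurate, with constants 1/2 and 1.\<close>

lemma decay_eq_growth_successor:
  assumes "best_index n"
  shows "decay U \<theta> (hclass U (\<lambda>i. cf_denom \<theta> (n i))) =
    growth U (hclass U (\<lambda>i. cf_denom \<theta> (Suc (n i))))"
proof -
  have "commensurate (\<lambda>i. inverse (cf_denom \<theta> (Suc (n i)))) (\<lambda>i. cf_dist \<theta> (n i))"
    using cf_dist_le cf_dist_ge less_imp_le[OF cf_denom_pos]
    by (intro commensurateI[of "1/2" 1] always_eventually allI)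
      (simp_all add: abs_of_pos[OF cf_dist_pos] del: cf_denom.simps)
  then show ?thesis
    unfolding decay_best_denom[OF assms] growth_hclass by (rule pclass_eqI[symmetric])
qed

section \<open>Implications between the four conditions\<close>

lemma succ_gap_iff_decay_less_growth:
  "(\<exists>q\<in>best_denoms U \<theta>. \<exists>q'. is_best_succ U \<theta> q q' \<and> pless U (growth U q') (growth U q)) \<longleftrightarrow>
   (\<exists>q\<in>best_denoms U \<theta>. pless U (decay U \<theta> q) (growth U q))"
proof
  assume "\<exists>q\<in>best_denoms U \<theta>. \<exists>q'. is_best_succ U \<theta> q q' \<and> pless U (growth U q') (growth U q)"
  then show "\<exists>q\<in>best_denoms U \<theta>. pless U (decay U \<theta> q) (growth U q)"
    unfolding is_best_succ_def using decay_eq_growth_successor by metis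
next
  assume "\<exists>q\<in>best_denoms U \<theta>. pless U (decay U \<theta> q) (growth U q)"
  then show "\<exists>q\<in>best_denoms U \<theta>. \<exists>q'. is_best_succ U \<theta> q q' \<and> pless U (growth U q') (growth U q)"
    unfolding is_best_succ_def best_denoms_def using decay_eq_growth_successor by fastforce
qed

lemma well_approximable_imp_succ_gap:
  assumes "\<theta> \<in> well_approximable"
  shows "\<exists>q\<in>best_denoms U \<theta>. \<exists>q'. is_best_succ U \<theta> q q' \<and> pless U (growth U q') (growth U q)"
proof -
  from assms obtain n where n: "best_index n"
    and r: "\<And>j. cf_denom \<theta> (n j) / cf_denom \<theta> (Suc (n j)) < 1 / Suc j"
    using well_approximable_best_index by blast
  let ?q = "hclass U (\<lambda>i. cf_denom \<theta> (n i))" and ?q' = "hclass U (\<lambda>i. cf_denom \<theta> (Suc (n i)))"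
  have "pless U (growth U ?q') (growth U ?q)"
    unfolding growth_hclass pless_pclass_iff
  proof (intro allI impI)
    fix e :: real assume "e > 0"
    obtain N where N: "inverse (Suc N) < e" using reals_Archimedean[OF \<open>e > 0\<close>] by blast
    \<comment> \<open>The ratio bound depends on the position \<open>i\<close> in the sequence, not
      on \<open>n i\<close>, so tails of \<open>i\<close> itself are used.\<close>
    have "\<forall>\<^sub>F i in U. N \<le> i"
      using U_le_sequentially eventually_ge_at_top[of N] by (auto simp: le_filter_def)
    then show "\<forall>\<^sub>F i in U. \<bar>inverse (real_of_int (cf_denom \<theta> (Suc (n i))))\<bar> <
        e * \<bar>inverse (real_of_int (cf_denom \<theta> (n i)))\<bar>"
    proof eventually_elim
      case (elim i)
      have "1 / real (Suc i) \<le> inverse (Suc N)" using elim by (simp add: field_simps)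
      with r[of i] N have "cf_denom \<theta> (n i) / cf_denom \<theta> (Suc (n i)) < e" by linarith
      then show ?case using cf_denom_pos[of "n i"] cf_denom_pos[of "Suc (n i)"]
        by (simp add: field_simps del: cf_denom.simps)
    qed
  qed
  moreover have "?q \<in> best_denoms U \<theta>" "is_best_succ U \<theta> ?q ?q'"
    using n by (auto simp: best_denoms_def is_best_succ_def)
  ultimately show ?thesis by blast
qed

text \<open>With the decay of \<open>q\<close> as threshold, \<open>q\<close> itself is a nonzero
  element: its growth exceeds the threshold strictly and its decay equals it.\<close>

lemma decay_less_growth_imp_growth_decay_group:
  assumes "q \<in> best_denoms U \<theta>" "pless U (decay U \<theta> q) (growth U q)"
  shows "decay U \<theta> q \<in> PP_eps U"
    and "growth_decay_group U \<theta> (decay U \<theta> q) (decay U \<theta> q) \<noteq> {hconst U 0}"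
proof -
  obtain n where n: "best_index n" and q: "q = hclass U (\<lambda>i. cf_denom \<theta> (n i))"
    using assms(1) by (auto simp: best_denoms_def)
  let ?d = "hclass U (\<lambda>i. cf_dist \<theta> (n i))"
  have dd: "decay U \<theta> q = pclass U ?d" unfolding q by (rule decay_best_denom[OF n])
  have "?d \<in> hinfinitesimals U"
    using best_denom_error_infinitesimal[OF n]
    by (simp add: hinfinitesimals_hclass abs_cf_error abs_of_pos[OF cf_dist_pos])
  moreover have "hless U (hconst U 0) ?d"
    by (simp add: hconst_def hless_hclass cf_dist_pos)
  moreover have "pclass U ?d \<in> PP U"
    unfolding PP_def pclass_def habs_hclass by (intro quotientI) (simp add: hnonneg_hclass)
  ultimately show "decay U \<theta> q \<in> PP_eps U" unfolding dd PP_eps_def by blast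
  have "q \<noteq> hconst U 0"
    using cf_denom_pos U_not_bot
    by (simp add: q hconst_def hclass_eq_iff less_imp_neq[symmetric] trivial_limit_def)
  moreover have "q \<in> dioph_group U \<theta>" unfolding q by (rule best_denom_in_dioph_group[OF n])
  ultimately show "growth_decay_group U \<theta> (decay U \<theta> q) (decay U \<theta> q) \<noteq> {hconst U 0}"
    using assms(2) by (auto simp: growth_decay_group_def ple_def)
qed

text \<open>Given \<open>e\<close> and \<open>N\<close>, finitely many conditions hold along
  \<open>U\<close>, so one index \<open>i\<close> satisfies them all, and
  \<open>\<bar>k i\<bar>\<close> is the required natural number.\<close>

lemma growth_decay_group_imp_well_approximable:
  assumes "\<mu> \<in> PP_eps U" "growth_decay_group U \<theta> \<mu> \<mu> \<noteq> {hconst U 0}"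
  shows "\<theta> \<in> well_approximable"
proof -
  obtain h where h: "\<mu> = pclass U (hclass U h)"
    using assms(1) by (auto simp: PP_eps_def hinfinitesimals_def elim!: hrealsE)
  obtain n where n: "n \<in> dioph_group U \<theta>" "n \<noteq> hconst U 0" "pless U \<mu> (growth U n)"
    "ple U (decay U \<theta> n) \<mu>"
    using assms(2) by (auto simp: growth_decay_group_def)
  obtain k m where k: "n = hclass U (\<lambda>i. of_int (k i))"
    and eps: "\<forall>r>0. \<forall>\<^sub>F i in U. \<bar>of_int (k i) * \<theta> - of_int (m i)\<bar> < r"
    using n(1) by (rule dioph_groupE)
  have k0: "\<forall>\<^sub>F i in U. k i \<noteq> 0"
    using n(2) by (simp add: k hconst_def hclass_eq_iff not_eventually_iff)
  have "pless U (decay U \<theta> n) (growth U n)"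
    using n(3,4) pless_pclass_trans
    unfolding ple_def k h decay_hclass(1)[OF eps] growth_hclass by metis
  then have less: "\<forall>r>0. \<forall>\<^sub>F i in U.
      \<bar>of_int (k i) * \<theta> - of_int (m i)\<bar> < r * \<bar>inverse (real_of_int (k i))\<bar>"
    unfolding k decay_hclass(1)[OF eps] growth_hclass pless_pclass_iff .
  show ?thesis unfolding well_approximable_iff
  proof (intro allI impI)
    fix e :: real and N :: nat assume "e > 0"
    \<comment> \<open>The second bound makes \<open>k i\<close> large: by best approximation, a
      nonzero integer with error below \<open>D_N\<close> has absolute value at least
      \<open>q_(N+1)\<close>.\<close>
    have "\<forall>\<^sub>F i in U. \<bar>of_int (k i) * \<theta> - of_int (m i)\<bar> < e * \<bar>inverse (real_of_int (k i))\<bar>"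
      "\<forall>\<^sub>F i in U. \<bar>of_int (k i) * \<theta> - of_int (m i)\<bar> < cf_dist \<theta> N"
      using less eps \<open>e > 0\<close> cf_dist_pos by auto
    with k0 have "\<forall>\<^sub>F i in U. k i \<noteq> 0 \<and>
      \<bar>of_int (k i) * \<theta> - of_int (m i)\<bar> < e * \<bar>inverse (real_of_int (k i))\<bar> \<and>
      \<bar>of_int (k i) * \<theta> - of_int (m i)\<bar> < cf_dist \<theta> N"
      by eventually_elim blast
    then obtain i where i: "k i \<noteq> 0"
      "\<bar>of_int (k i) * \<theta> - of_int (m i)\<bar> < e * \<bar>inverse (real_of_int (k i))\<bar>"
      "\<bar>of_int (k i) * \<theta> - of_int (m i)\<bar> < cf_dist \<theta> N"
      using eventually_happens'[OF U_not_bot] by blast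
    define j where "j = nat \<bar>k i\<bar>"
    have j: "real j = \<bar>of_int (k i)\<bar>" "0 < real j" using i(1) by (auto simp: j_def)
    have "cf_denom \<theta> (Suc N) \<le> \<bar>k i\<bar>"
      using cf_best_approximation[OF i(1), of N "m i"] i(3) by linarith
    then have "j \<ge> N" using cf_denom_ge[of "Suc N"] by (simp add: j_def)
    \<comment> \<open>If \<open>k i\<close> is negative, replacing it by \<open>j\<close> changes
      the sign of the approximating integer as well.\<close>
    have "infdist (real j * \<theta>) \<int> \<le> dist (real j * \<theta>) (of_int (sgn (k i) * m i))"
      by (intro infdist_le) simp
    also have "\<dots> = \<bar>of_int (k i) * \<theta> - of_int (m i)\<bar>"
      using i(1) by (cases "k i > 0") (auto simp: j dist_real_def)
    also have "\<dots> < e / real j" using i(2) by (simp add: j(1) divide_inverse abs_inverse)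
    finally have "real j * infdist (real j * \<theta>) \<int> < e" using j(2) by (simp add: field_simps)
    with \<open>j \<ge> N\<close> show "\<exists>n\<ge>N. real n * infdist (real n * \<theta>) \<int> < e" by blast
  qed
qed

section \<open>Gaps in the order of best growths\<close>

lemma not_pless_growth_cf_denom:
  assumes "\<forall>\<^sub>F i in U. a i \<le> b i"
  shows "\<not> pless U (growth U (hclass U (\<lambda>i. cf_denom \<theta> (a i))))
    (growth U (hclass U (\<lambda>i. cf_denom \<theta> (b i))))"
proof
  assume "pless U (growth U (hclass U (\<lambda>i. cf_denom \<theta> (a i))))
    (growth U (hclass U (\<lambda>i. cf_denom \<theta> (b i))))"
  \<comment> \<open>The factor 1 suffices for a contradiction, since inverses reverse the order of
    the denominators.\<close>
  then have "\<forall>\<^sub>F i in U. \<bar>inverse (real_of_int (cf_denom \<theta> (a i)))\<bar> <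
      1 * \<bar>inverse (real_of_int (cf_denom \<theta> (b i)))\<bar>"
    unfolding growth_hclass pless_pclass_iff by (metis zero_less_one)
  with assms have "\<forall>\<^sub>F i in U. False"
  proof eventually_elim
    case (elim i)
    then have "inverse (real_of_int (cf_denom \<theta> (b i))) \<le> inverse (real_of_int (cf_denom \<theta> (a i)))"
      using cf_denom_mono cf_denom_pos by (intro le_imp_inverse_le) auto
    with elim show ?case using cf_denom_pos[of "a i"] cf_denom_pos[of "b i"] by (simp add: abs_of_pos)
  qed
  then show False using U_not_bot by (simp add: trivial_limit_def)
qed

lemma succ_gap_imp_not_dense:
  assumes "is_best_succ U \<theta> q q'" "pless U (growth U q') (growth U q)"
  shows "\<not> dense_order_on (pless U) (best_growths U \<theta>)"
proof
  assume dense: "dense_order_on (pless U) (best_growths U \<theta>)"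
  obtain n where n: "best_index n" and q: "q = hclass U (\<lambda>i. cf_denom \<theta> (n i))"
    and q': "q' = hclass U (\<lambda>i. cf_denom \<theta> (Suc (n i)))"
    using assms(1) by (auto simp: is_best_succ_def)
  have "best_index (\<lambda>i. Suc (n i))"
    using n by (auto simp: best_index_def intro: filterlim_compose[OF filterlim_Suc])
  then have "q \<in> best_denoms U \<theta>" "q' \<in> best_denoms U \<theta>"
    using n by (auto simp: best_denoms_def q q' simp del: cf_denom.simps)
  then have "growth U q \<in> best_growths U \<theta>" "growth U q' \<in> best_growths U \<theta>"
    by (auto simp: best_growths_def)
  with dense assms(2) obtain z where "z \<in> best_growths U \<theta>"
    and z: "pless U (growth U q') z" "pless U z (growth U q)"
    unfolding dense_order_on_def by blast
  then obtain m where zm: "z = growth U (hclass U (\<lambda>i. cf_denom \<theta> (m i)))"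
    by (auto simp: best_growths_def best_denoms_def)
  show False
  \<comment> \<open>No integer lies strictly between \<open>n i\<close> and
    \<open>Suc (n i)\<close>, so each case contradicts one of the two inequalities for
    \<open>z\<close>.\<close>
  proof (cases "\<forall>\<^sub>F i in U. m i \<le> n i")
    case True
    with z(2) show False unfolding q zm by (simp add: not_pless_growth_cf_denom)
  next
    case False
    then have "\<forall>\<^sub>F i in U. Suc (n i) \<le> m i"
      by (simp add: not_eventually_iff not_le Suc_le_eq)
    with z(1) show False unfolding q' zm
      using not_pless_growth_cf_denom[of "\<lambda>i. Suc (n i)" m] by (simp del: cf_denom.simps)
  qed
qed

end

theorem theorem6:
  fixes U :: "nat filter" and \<theta> :: real
  assumes "nonprincipal_ultrafilter U" and "\<theta> \<notin> \<rat>"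
  shows "(\<theta> \<in> well_approximable \<longleftrightarrow>
           (\<exists>\<mu>\<in>PP_eps U. growth_decay_group U \<theta> \<mu> \<mu> \<noteq> {hconst U 0})) \<and>
         (\<theta> \<in> well_approximable \<longleftrightarrow>
           (\<exists>q\<in>best_denoms U \<theta>. \<exists>q'. is_best_succ U \<theta> q q' \<and> pless U (growth U q') (growth U q))) \<and>
         (\<theta> \<in> well_approximable \<longleftrightarrow>
           (\<exists>q\<in>best_denoms U \<theta>. pless U (decay U \<theta> q) (growth U q))) \<and>
         ((\<exists>q\<in>best_denoms U \<theta>. \<exists>q'. is_best_succ U \<theta> q q' \<and> pless U (growth U q') (growth U q)) \<longrightarrow>
           \<not> dense_order_on (pless U) (best_growths U \<theta>))"
proof -
  interpret ultra_irrational U \<theta> by unfold_locales fact+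
  \<comment> \<open>The implications run from (i) to (iii), which is equivalent to (iv), then to
    (ii) and back to (i).\<close>
  show ?thesis
    using well_approximable_imp_succ_gap succ_gap_iff_decay_less_growth
      decay_less_growth_imp_growth_decay_group growth_decay_group_imp_well_approximable
      succ_gap_imp_not_dense
    by meson
qed

end
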